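(* Let $\mathcal M_d=(Q,L_d,f_d)$ be a forced discrete Lagrangian system, with $Q$ a finite-dimensional real vector space, that satisfies the modified hyperregularity condition, and let $(Q,H_d,\phi_d)$ be the forced discrete Hamiltonian system constructed from it by $$H_d(q,p)=p\,q^+(q,p)-L_d(q,q^+(q,p)),\qquad \phi_d=\big((\widetilde{\mathbb F}_{f_d}L_d)^{-1}\big)^*f_d .$$ Let $q_\cdot=(q_0,\dots,q_N)$ be a discrete curve in $Q$ and $(q_\cdot,p_\cdot)=((q_0,p_0),\dots,(q_N,p_N))$ a discrete curve in $T^*Q$ related by $$(q_k,p_k)=\mathbb F^+_{f_d}L_d(q_{k-1},q_k)\ \text{ for }k=1,\dots,N,\qquad (q_0,p_0)=\mathbb F^-_{\phi_d}H_d(q_0,p_1).$$ Then $q_\cdot$ is a trajectory of $\mathcal M_d$ if and only if $(q_\cdot,p_\cdot)$ is an extended trajectory of $(Q,H_d,\phi_d)$.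
   Context: **Lagrangian side.** A forced discrete Lagrangian system (FDLS) is a triple $(Q,L_d,f_d)$ with $L_d:Q\times Q\to\mathbb R$ smooth and $f_d$ a smooth 1-form on $Q\times Q$, decomposed as $f_d(q_0,q_1)(\delta q_0,\delta q_1)=f_d^-(q_0,q_1)(\delta q_0)+f_d^+(q_0,q_1)(\delta q_1)$. A discrete curve $(q_0,\dots,q_N)$ in $Q$ is a trajectory if $\delta\big(\sum_{k=0}^{N-1}L_d(q_k,q_{k+1})\big)+\sum_{k=0}^{N-1}f_d(q_k,q_{k+1})(\delta q_k,\delta q_{k+1})=0$ for all variations with $\delta q_0=0$, $\delta q_N=0$; equivalently, $$D_2L_d(q_{k-1},q_k)+D_1L_d(q_k,q_{k+1})+f_d^+(q_{k-1},q_k)+f_d^-(q_k,q_{k+1})=0,\qquad k=1,\dots,N-1.$$ Identify $T^*Q\simeq Q\times Q^*$. The Legendre transforms $Q\times Q\to T^*Q$ are $$\mathbb F^+_{f_d}L_d(q_0,q_1)=(q_1,\,D_2L_d(q_0,q_1)+f_d^+(q_0,q_1)),\quad \mathbb F^-_{f_d}L_d(q_0,q_1)=(q_0,\,-D_1L_d(q_0,q_1)-f_d^-(q_0,q_1)).$$ Define $\widetilde{\mathbb F}_{f_d}L_d:Q\times Q\to Q\times Q^*$ by $\widetilde{\mathbb F}_{f_d}L_d(q,q')=(q,\,D_2L_d(q,q')+f_d^+(q,q'))$. The FDLS satisfies the modified hyperregularity condition (MHC) if $\widetilde{\mathbb F}_{f_d}L_d$ is a (global) diffeomorphism. In that case $q^+:Q\times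 Q^*\to Q$ is the function with $(\widetilde{\mathbb F}_{f_d}L_d)^{-1}(q,p)=(q,q^+(q,p))$. **Hamiltonian side.** A forced discrete Hamiltonian system (FDHS) is a triple $(Q,H_d,\phi_d)$ with $H_d:T^*Q\to\mathbb R$ smooth and $\phi_d$ a 1-form on $T^*Q$, decomposed as $\phi_d(q,p)(\delta q,\delta p)=\phi_d^q(q,p)(\delta q)+\phi_d^p(q,p)(\delta p)$. Set $\mathbb F^-_{\phi_d}H_d(q_0,p_1)=(q_0,\,D_1H_d(q_0,p_1)-\phi_d^q(q_0,p_1))$. A discrete curve $((q_0,p_0),\dots,(q_N,p_N))$ is an extended trajectory if and only if $$q_{k+1}=D_2H_d(q_k,p_{k+1})-\phi_d^p(q_k,p_{k+1}),\qquad p_k=D_1H_d(q_k,p_{k+1})-\phi_d^q(q_k,p_{k+1}),\qquad k=0,\dots,N-1.$$ *)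

theory Defs
  imports "HOL-Analysis.Analysis"
begin

text \<open>
  The finite-dimensional real vector space Q is a normed type together with a finite spanning
  set, so that dimension 0 is included; the choice of norm affects neither the topology nor
  differentiability.  The dual of Q is the type of bounded linear functionals, which for
  finite-dimensional Q are all linear functionals.
\<close>

type_synonym 'a dual = "'a \<Rightarrow>\<^sub>L real"
type_synonym 'a one_form = "'a \<Rightarrow> 'a dual"

definition finite_dim :: "'a::real_normed_vector itself \<Rightarrow> bool" where
  "finite_dim _ \<longleftrightarrow> (\<exists>B::'a set. finite B \<and> span B = UNIV)"

text \<open>
  On a finite-dimensional domain a map is of class \<open>C\<^sup>n\<^sup>+\<^sup>1\<close> iff it is differentiable and its
  derivative in each fixed direction is of class \<open>C\<^sup>n\<close>.  This avoids the growing types of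
  iterated Frechet derivatives.
\<close>

primrec C_k :: "nat \<Rightarrow> ('a::real_normed_vector \<Rightarrow> 'b::real_normed_vector) \<Rightarrow> bool" where
  "C_k 0 f \<longleftrightarrow> continuous_on UNIV f"
| "C_k (Suc n) f \<longleftrightarrow>
     (\<forall>x. f differentiable (at x)) \<and> (\<forall>v. C_k n (\<lambda>x. frechet_derivative f (at x) v))"

definition smooth :: "('a::real_normed_vector \<Rightarrow> 'b::real_normed_vector) \<Rightarrow> bool" where
  "smooth f \<longleftrightarrow> (\<forall>n. C_k n f)"

definition diffeomorphism :: "('a::real_normed_vector \<Rightarrow> 'b::real_normed_vector) \<Rightarrow> bool" where
  "diffeomorphism f \<longleftrightarrow> bij f \<and> smooth f \<and> smooth (inv f)"

definition D1 :: "('a::real_normed_vector \<times> 'b::real_normed_vector \<Rightarrow> real) \<Rightarrow> 'a \<times> 'b \<Rightarrow> 'a dual"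
  where "D1 F z = Blinfun (frechet_derivative (\<lambda>x. F (x, snd z)) (at (fst z)))"

definition D2 :: "('a::real_normed_vector \<times> 'b::real_normed_vector \<Rightarrow> real) \<Rightarrow> 'a \<times> 'b \<Rightarrow> 'b dual"
  where "D2 F z = Blinfun (frechet_derivative (\<lambda>y. F (fst z, y)) (at (snd z)))"

text \<open>
  The two parts of a 1-form on a product:
  \<open>\<omega> z (u, v) = form1 \<omega> z u + form2 \<omega> z v\<close>.  For a discrete force \<open>f\<close> these are \<open>f\<^sup>-\<close> and \<open>f\<^sup>+\<close>;
  for a form \<open>\<phi>\<close> on the cotangent bundle they are \<open>\<phi>\<^sup>q\<close> and \<open>\<phi>\<^sup>p\<close>.
\<close>

definition form1 :: "('a::real_normed_vector \<times> 'b::real_normed_vector) one_form \<Rightarrow> 'a \<times> 'b \<Rightarrow> 'a dual"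
  where "form1 \<omega> z = Blinfun (\<lambda>u. blinfun_apply (\<omega> z) (u, 0))"

definition form2 :: "('a::real_normed_vector \<times> 'b::real_normed_vector) one_form \<Rightarrow> 'a \<times> 'b \<Rightarrow> 'b dual"
  where "form2 \<omega> z = Blinfun (\<lambda>v. blinfun_apply (\<omega> z) (0, v))"

definition pullback ::
  "('a::real_normed_vector \<Rightarrow> 'b::real_normed_vector) \<Rightarrow> 'b one_form \<Rightarrow> 'a one_form" where
  "pullback g \<omega> z = Blinfun (\<lambda>v. blinfun_apply (\<omega> (g z)) (frechet_derivative g (at z) v))"


definition FDLS :: "('a::real_normed_vector \<times> 'a \<Rightarrow> real) \<Rightarrow> ('a \<times> 'a) one_form \<Rightarrow> bool" where
  "FDLS L f \<longleftrightarrow> smooth L \<and> smooth f"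

text \<open>
  A discrete curve \<open>(q\<^sub>0, \<dots>, q\<^sub>N)\<close> is given by a function on the naturals of which only
  the values at indices up to \<open>N\<close> are used.
\<close>

definition discrete_action ::
  "('a::real_normed_vector \<times> 'a \<Rightarrow> real) \<Rightarrow> nat \<Rightarrow> (nat \<Rightarrow> 'a) \<Rightarrow> real" where
  "discrete_action L N q = (\<Sum>k<N. L (q k, q (Suc k)))"

definition FDLS_trajectory ::
  "('a::real_normed_vector \<times> 'a \<Rightarrow> real) \<Rightarrow> ('a \<times> 'a) one_form \<Rightarrow> nat \<Rightarrow> (nat \<Rightarrow> 'a) \<Rightarrow> bool" where
  "FDLS_trajectory L f N q \<longleftrightarrow>
     (\<forall>\<delta>q. \<delta>q 0 = 0 \<and> \<delta>q N = 0 \<longrightarrow>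
        deriv (\<lambda>t. discrete_action L N (\<lambda>k. q k + t *\<^sub>R \<delta>q k)) 0
        + (\<Sum>k<N. blinfun_apply (f (q k, q (Suc k))) (\<delta>q k, \<delta>q (Suc k))) = 0)"

definition Legendre_plus ::
  "('a::real_normed_vector \<times> 'a \<Rightarrow> real) \<Rightarrow> ('a \<times> 'a) one_form \<Rightarrow> 'a \<times> 'a \<Rightarrow> 'a \<times> 'a dual" where
  "Legendre_plus L f z = (snd z, D2 L z + form2 f z)"

definition Legendre_tilde ::
  "('a::real_normed_vector \<times> 'a \<Rightarrow> real) \<Rightarrow> ('a \<times> 'a) one_form \<Rightarrow> 'a \<times> 'a \<Rightarrow> 'a \<times> 'a dual" where
  "Legendre_tilde L f z = (fst z, D2 L z + form2 f z)"

definition MHC :: "('a::real_normed_vector \<times> 'a \<Rightarrow> real) \<Rightarrow> ('a \<times> 'a) one_form \<Rightarrow> bool" where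
  "MHC L f \<longleftrightarrow> diffeomorphism (Legendre_tilde L f)"

definition q_plus ::
  "('a::real_normed_vector \<times> 'a \<Rightarrow> real) \<Rightarrow> ('a \<times> 'a) one_form \<Rightarrow> 'a \<times> 'a dual \<Rightarrow> 'a" where
  "q_plus L f z = snd (inv (Legendre_tilde L f) z)"


definition Legendre_minus_H ::
  "('a::real_normed_vector \<times> 'a dual \<Rightarrow> real) \<Rightarrow> ('a \<times> 'a dual) one_form
     \<Rightarrow> 'a \<times> 'a dual \<Rightarrow> 'a \<times> 'a dual" where
  "Legendre_minus_H H \<phi> z = (fst z, D1 H z - form1 \<phi> z)"

text \<open>
  \<open>D2 H\<close> and \<open>\<phi>\<^sup>p\<close> take values in the bidual of Q, which is identified with Q
  through the canonical evaluation map.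
\<close>

definition to_bidual :: "'a::real_normed_vector \<Rightarrow> 'a dual dual" where
  "to_bidual q = Blinfun (\<lambda>p. blinfun_apply p q)"

definition FDHS_extended_trajectory ::
  "('a::real_normed_vector \<times> 'a dual \<Rightarrow> real) \<Rightarrow> ('a \<times> 'a dual) one_form
     \<Rightarrow> nat \<Rightarrow> (nat \<Rightarrow> 'a) \<Rightarrow> (nat \<Rightarrow> 'a dual) \<Rightarrow> bool" where
  "FDHS_extended_trajectory H \<phi> N q p \<longleftrightarrow>
     (\<forall>k<N. to_bidual (q (Suc k)) = D2 H (q k, p (Suc k)) - form2 \<phi> (q k, p (Suc k))
          \<and> p k = D1 H (q k, p (Suc k)) - form1 \<phi> (q k, p (Suc k)))"

definition Hamiltonian_of ::
  "('a::real_normed_vector \<times> 'a \<Rightarrow> real) \<Rightarrow> ('a \<times> 'a) one_form \<Rightarrow> 'a \<times> 'a dual \<Rightarrow> real" where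
  "Hamiltonian_of L f z =
     blinfun_apply (snd z) (q_plus L f z) - L (fst z, q_plus L f z)"

definition force_of ::
  "('a::real_normed_vector \<times> 'a \<Rightarrow> real) \<Rightarrow> ('a \<times> 'a) one_form \<Rightarrow> ('a \<times> 'a dual) one_form" where
  "force_of L f = pullback (inv (Legendre_tilde L f)) f"

end

theory Submission
  imports Defs
begin

text \<open>
  Write \<open>(q, p) = (q, D\<^sub>2L + f\<^sup>+)\<close> at \<open>(q, w)\<close> with \<open>w = q\<^sup>+(q, p)\<close>.  When \<open>H = p w - L(q, w)\<close> is
  differentiated, the terms containing the derivative of \<open>q\<^sup>+\<close> add up to \<open>f\<^sup>+\<close> applied to that
  derivative, and \<open>\<phi>\<close> contains exactly the same term.  Hence \<open>dH - \<phi>\<close> has components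
  \<open>-D\<^sub>1L - f\<^sup>-\<close> and \<open>w\<close>, without derivatives of \<open>q\<^sup>+\<close>.  The first Hamiltonian equation therefore
  holds automatically along the given curves, and the second one is
  \<open>p\<^sub>k + D\<^sub>1L + f\<^sup>- = 0\<close>, which is the coefficient of \<open>\<delta>q\<^sub>k\<close> in the forced variational principle
  after a summation by parts.
\<close>

lemma smooth_differentiable: "smooth g \<Longrightarrow> g differentiable (at x)"
  unfolding smooth_def by (metis C_k.simps(2))

text \<open>The partial map is \<open>F\<close> composed with an affine inclusion, so its derivative
  is bounded linear; only then does \<open>blinfun_apply\<close> undo the \<open>Blinfun\<close> in
  the definition. The same holds for \<open>D2_apply\<close>.\<close>

lemma D1_apply:
  assumes "(F has_derivative F') (at z)"
  shows "blinfun_apply (D1 F z) u = F' (u, 0)"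
proof -
  have "(F has_derivative F') (at (fst z, snd z))"
    using assms by simp
  then have d: "((\<lambda>x. F (x, snd z)) has_derivative (\<lambda>u. F' (u, 0))) (at (fst z))"
    by (rule has_derivative_compose[rotated]) (auto intro!: derivative_eq_intros)
  show ?thesis
    unfolding D1_def frechet_derivative_at[OF d, symmetric]
    using has_derivative_bounded_linear[OF d] by (simp add: bounded_linear_Blinfun_apply)
qed

lemma D2_apply:
  assumes "(F has_derivative F') (at z)"
  shows "blinfun_apply (D2 F z) v = F' (0, v)"
proof -
  have "(F has_derivative F') (at (fst z, snd z))"
    using assms by simp
  then have d: "((\<lambda>y. F (fst z, y)) has_derivative (\<lambda>v. F' (0, v))) (at (snd z))"
    by (rule has_derivative_compose[rotated]) (auto intro!: derivative_eq_intros)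
  show ?thesis
    unfolding D2_def frechet_derivative_at[OF d, symmetric]
    using has_derivative_bounded_linear[OF d] by (simp add: bounded_linear_Blinfun_apply)
qed

lemma linear_Pair_split:
  assumes "linear g"
  shows "g (u, v) = g (u, 0) + g (0, v)"
  using linear_add[OF assms, of "(u, 0)" "(0, v)"] by simp

lemma has_derivative_eq_D1_D2:
  assumes "(F has_derivative F') (at z)"
  shows "F' (u, v) = blinfun_apply (D1 F z) u + blinfun_apply (D2 F z) v"
  by (simp add: D1_apply[OF assms] D2_apply[OF assms]
      linear_Pair_split[OF has_derivative_linear[OF assms], of u v])

lemma form1_apply: "blinfun_apply (form1 \<omega> z) u = blinfun_apply (\<omega> z) (u, 0)"
  unfolding form1_def
  by (subst bounded_linear_Blinfun_apply)
    (auto intro!: bounded_linear_intros)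

lemma form2_apply: "blinfun_apply (form2 \<omega> z) v = blinfun_apply (\<omega> z) (0, v)"
  unfolding form2_def
  by (subst bounded_linear_Blinfun_apply)
    (auto intro!: bounded_linear_intros)

lemma blinfun_apply_eq_form1_form2:
  "blinfun_apply (\<omega> z) (u, v) = blinfun_apply (form1 \<omega> z) u + blinfun_apply (form2 \<omega> z) v"
  by (simp add: form1_apply form2_apply blinfun.add_right[symmetric])

lemma to_bidual_apply: "blinfun_apply (to_bidual x) r = blinfun_apply r x"
  unfolding to_bidual_def
  by (subst bounded_linear_Blinfun_apply) (auto intro!: bounded_linear_intros)

lemma pullback_apply:
  assumes "(g has_derivative g') (at z)"
  shows "blinfun_apply (pullback g \<omega> z) v = blinfun_apply (\<omega> (g z)) (g' v)"
  unfolding pullback_def frechet_derivative_at[OF assms, symmetric]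
  by (subst bounded_linear_Blinfun_apply)
    (auto intro!: bounded_linear_compose[OF _ has_derivative_bounded_linear[OF assms]]
      bounded_linear_intros)

text \<open>The point of the cotangent bundle is given as the image of \<open>(x, w)\<close>, so
  that along a curve one can take \<open>x = q k\<close>, \<open>w = q (Suc k)\<close>,
  \<open>p = p (Suc k)\<close> without evaluating \<open>q_plus\<close>.\<close>

lemma Hamiltonian_force_at_Legendre_tilde:
  fixes L :: "'a::real_normed_vector \<times> 'a \<Rightarrow> real"
  assumes L: "smooth L" and MHC: "MHC L f"
    and p: "p = D2 L (x, w) + form2 f (x, w)"
  shows "D1 (Hamiltonian_of L f) (x, p) - form1 (force_of L f) (x, p)
           = - D1 L (x, w) - form1 f (x, w)"
    and "D2 (Hamiltonian_of L f) (x, p) - form2 (force_of L f) (x, p) = to_bidual w"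
proof -
  let ?F = "Legendre_tilde L f" and ?H = "Hamiltonian_of L f" and ?\<phi> = "force_of L f"
  define G where "G = inv ?F"
  have bij: "bij ?F" and "smooth G"
    using MHC by (auto simp: MHC_def diffeomorphism_def G_def)
  have G: "G (x, p) = (x, w)"
    using bij p inv_f_f[of ?F "(x, w)"] by (simp add: G_def Legendre_tilde_def bij_is_inj)
  have fst_G: "fst (G z) = fst z" for z
    using surj_f_inv_f[OF bij_is_surj[OF bij], of z] by (metis G_def Legendre_tilde_def fst_conv)
  have G_eq: "G z = (fst z, snd (G z))" for z
    by (simp add: prod_eq_iff fst_G)
  obtain G' where dG: "(G has_derivative G') (at (x, p))"
    using smooth_differentiable[OF \<open>smooth G\<close>] by (auto simp: differentiable_def)
  obtain L' where dL: "(L has_derivative L') (at (x, w))"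
    using smooth_differentiable[OF L] by (auto simp: differentiable_def)
  \<comment> \<open>Since \<open>G\<close> preserves base points, differentiating
    \<open>fst (G z) = fst z\<close> determines the first component of \<open>G' h\<close>; the
    second is the derivative of \<open>q_plus\<close>.\<close>
  have "((\<lambda>z. fst (G z)) has_derivative (\<lambda>h. fst (G' h))) (at (x, p))"
    by (rule has_derivative_fst[OF dG])
  then have "(fst has_derivative (\<lambda>h. fst (G' h))) (at (x, p))"
    by (simp add: fst_G)
  then have fst_G': "fst (G' h) = fst h" for h
    using has_derivative_unique[OF _ has_derivative_fst[OF has_derivative_ident]]
    by (metis (no_types, lifting))
  have H: "?H = (\<lambda>z. blinfun_apply (snd z) (snd (G z)) - L (G z))"
    by (rule ext)
      (simp add: Hamiltonian_of_def q_plus_def flip: G_def G_eq)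
  have dLG: "((\<lambda>z. L (G z)) has_derivative (\<lambda>h. L' (G' h))) (at (x, p))"
    by (rule has_derivative_compose[OF dG]) (simp add: G dL)
  have dH: "(?H has_derivative
      (\<lambda>h. blinfun_apply p (snd (G' h)) + blinfun_apply (snd h) w - L' (G' h))) (at (x, p))"
    unfolding H
    by (rule derivative_eq_intros blinfun.FDERIV dLG dG has_derivative_ident refl)+
      (simp add: G)
  have \<phi>: "blinfun_apply (?\<phi> (x, p)) h = blinfun_apply (f (x, w)) (G' h)" for h
    using pullback_apply[OF dG, of f] by (simp add: force_of_def G_def[symmetric] G)
  \<comment> \<open>The momentum \<open>p\<close> splits into \<open>D2 L\<close>, which cancels
    against the second slot of \<open>L'\<close>, and \<open>form2 f\<close>, which cancels against
    the force. Taking \<open>h = (u, 0)\<close> and \<open>h = (0, r)\<close> then gives the two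
    claims.\<close>
  have key: "blinfun_apply p (snd (G' h)) + blinfun_apply (snd h) w - L' (G' h)
      - blinfun_apply (?\<phi> (x, p)) h
      = blinfun_apply (snd h) w - blinfun_apply (D1 L (x, w) + form1 f (x, w)) (fst h)" for h
  proof -
    have G'_h: "G' h = (fst h, snd (G' h))"
      by (simp add: prod_eq_iff fst_G')
    have "blinfun_apply p (snd (G' h)) = blinfun_apply (D2 L (x, w)) (snd (G' h))
        + blinfun_apply (form2 f (x, w)) (snd (G' h))"
      by (simp add: p blinfun.add_left)
    moreover have "L' (G' h) = blinfun_apply (D1 L (x, w)) (fst h)
        + blinfun_apply (D2 L (x, w)) (snd (G' h))"
      by (subst G'_h) (rule has_derivative_eq_D1_D2[OF dL])
    moreover have "blinfun_apply (?\<phi> (x, p)) h = blinfun_apply (form1 f (x, w)) (fst h)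
        + blinfun_apply (form2 f (x, w)) (snd (G' h))"
      unfolding \<phi> by (subst G'_h) (rule blinfun_apply_eq_form1_form2)
    ultimately show ?thesis by (simp add: blinfun.add_left)
  qed
  show "D1 ?H (x, p) - form1 ?\<phi> (x, p) = - D1 L (x, w) - form1 f (x, w)"
  proof (rule blinfun_eqI)
    fix u
    show "blinfun_apply (D1 ?H (x, p) - form1 ?\<phi> (x, p)) u
        = blinfun_apply (- D1 L (x, w) - form1 f (x, w)) u"
      using key[of "(u, 0)"]
      by (simp add: blinfun.diff_left blinfun.add_left blinfun.minus_left D1_apply[OF dH]
          form1_apply[of ?\<phi>])
  qed
  show "D2 ?H (x, p) - form2 ?\<phi> (x, p) = to_bidual w"
  proof (rule blinfun_eqI)
    fix r
    show "blinfun_apply (D2 ?H (x, p) - form2 ?\<phi> (x, p)) r = blinfun_apply (to_bidual w) r"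
      using key[of "(0, r)"]
      by (simp add: blinfun.diff_left D2_apply[OF dH] form2_apply[of ?\<phi>] to_bidual_apply)
  qed
qed

lemma deriv_discrete_action:
  fixes L :: "'a::real_normed_vector \<times> 'a \<Rightarrow> real"
  assumes "smooth L"
  shows "deriv (\<lambda>t. discrete_action L N (\<lambda>k. q k + t *\<^sub>R d k)) 0
    = (\<Sum>k<N. blinfun_apply (D1 L (q k, q (Suc k))) (d k)
        + blinfun_apply (D2 L (q k, q (Suc k))) (d (Suc k)))"
proof -
  have "((\<lambda>t. L (q k + t *\<^sub>R d k, q (Suc k) + t *\<^sub>R d (Suc k))) has_field_derivative
      blinfun_apply (D1 L (q k, q (Suc k))) (d k)
        + blinfun_apply (D2 L (q k, q (Suc k))) (d (Suc k))) (at 0)" for k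
  proof -
    obtain L' where dL: "(L has_derivative L') (at (q k, q (Suc k)))"
      using smooth_differentiable[OF assms] by (auto simp: differentiable_def)
    have c: "((\<lambda>t::real. (q k + t *\<^sub>R d k, q (Suc k) + t *\<^sub>R d (Suc k))) has_derivative
        (\<lambda>t. (t *\<^sub>R d k, t *\<^sub>R d (Suc k)))) (at 0)"
      by (auto intro!: derivative_eq_intros)
    have "((\<lambda>t. L (q k + t *\<^sub>R d k, q (Suc k) + t *\<^sub>R d (Suc k))) has_derivative
        (\<lambda>t. L' (t *\<^sub>R d k, t *\<^sub>R d (Suc k)))) (at 0)"
      by (rule has_derivative_compose[OF c]) (simp add: dL)
    \<comment> \<open>By linearity of \<open>L'\<close> the factor \<open>t\<close> comes out, so
      this derivative is multiplication by a constant.\<close>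
    then show ?thesis
      by (simp add: has_field_derivative_def has_derivative_eq_D1_D2[OF dL]
          blinfun.scaleR_right distrib_left[symmetric] mult_commute_abs)
  qed
  then show ?thesis
    unfolding discrete_action_def by (intro DERIV_imp_deriv DERIV_sum)
qed

text \<open>For interior \<open>k\<close> these are the discrete Euler-Lagrange equations, with the
  contribution of the preceding pair renamed to \<open>p k\<close>. Index 0 stays out:
  \<open>p 0\<close> is arbitrary here, and variations with fixed ends do not test it.\<close>

lemma FDLS_trajectory_iff:
  fixes L :: "'a::real_normed_vector \<times> 'a \<Rightarrow> real"
  assumes L: "smooth L"
    and p: "\<And>k. k < N \<Longrightarrow> p (Suc k) = D2 L (q k, q (Suc k)) + form2 f (q k, q (Suc k))"
  shows "FDLS_trajectory L f N q \<longleftrightarrow>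
    (\<forall>k. 0 < k \<and> k < N \<longrightarrow> p k = - D1 L (q k, q (Suc k)) - form1 f (q k, q (Suc k)))"
proof -
  define A where "A k = D1 L (q k, q (Suc k)) + form1 f (q k, q (Suc k)) + p k" for k
  have variation: "deriv (\<lambda>t. discrete_action L N (\<lambda>k. q k + t *\<^sub>R d k)) 0
      + (\<Sum>k<N. blinfun_apply (f (q k, q (Suc k))) (d k, d (Suc k)))
      = (\<Sum>k<N. blinfun_apply (A k) (d k))" (is "?V = _") if d: "d 0 = 0" "d N = 0" for d
  proof -
    \<comment> \<open>\<open>A k - p k\<close> is the first-slot contribution of the pair starting
      at \<open>k\<close>; the second-slot contribution is \<open>p (Suc k)\<close>.\<close>
    have "?V = (\<Sum>k<N. blinfun_apply (A k - p k) (d k) + blinfun_apply (p (Suc k)) (d (Suc k)))"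
      unfolding deriv_discrete_action[OF L] sum.distrib[symmetric]
      by (intro sum.cong refl)
        (simp add: p A_def blinfun_apply_eq_form1_form2 blinfun.add_left)
    also have "\<dots> = (\<Sum>k<N. blinfun_apply (A k) (d k))
        + ((\<Sum>k<N. blinfun_apply (p (Suc k)) (d (Suc k))) - (\<Sum>k<N. blinfun_apply (p k) (d k)))"
      by (simp add: blinfun.diff_left sum.distrib sum_subtractf)
    \<comment> \<open>The sum telescopes to the boundary terms at \<open>N\<close> and 0, where
      \<open>d\<close> vanishes.\<close>
    also have "(\<Sum>k<N. blinfun_apply (p (Suc k)) (d (Suc k))) - (\<Sum>k<N. blinfun_apply (p k) (d k)) = 0"
      unfolding sum_subtractf[symmetric]
      by (subst sum_lessThan_telescope) (simp add: d)
    finally show ?thesis by simp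
  qed
  have A_0: "A k = 0 \<longleftrightarrow> p k = - D1 L (q k, q (Suc k)) - form1 f (q k, q (Suc k))" for k
    unfolding A_def by (simp add: eq_diff_eq eq_neg_iff_add_eq_0 ac_simps)
  have "FDLS_trajectory L f N q \<longleftrightarrow> (\<forall>k. 0 < k \<and> k < N \<longrightarrow> A k = 0)"
  proof
    assume traj: "FDLS_trajectory L f N q"
    show "\<forall>k. 0 < k \<and> k < N \<longrightarrow> A k = 0"
    proof (intro allI impI blinfun_eqI)
      fix j v assume j: "0 < j \<and> j < N"
      \<comment> \<open>A variation concentrated at \<open>j\<close> isolates \<open>A j\<close>; it
        is admissible because \<open>j\<close> is interior.\<close>
      let ?d = "\<lambda>k::nat. if k = j then v else (0::'a)"
      have "(\<Sum>k<N. blinfun_apply (A k) (?d k)) = 0"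
        using traj[unfolded FDLS_trajectory_def, rule_format, of ?d] variation[of ?d] j by simp
      also have "(\<Sum>k<N. blinfun_apply (A k) (?d k)) = (\<Sum>k<N. if k = j then blinfun_apply (A k) v else 0)"
        by (intro sum.cong) auto
      finally show "blinfun_apply (A j) v = blinfun_apply 0 v"
        using j by simp
    qed
  next
    assume "\<forall>k. 0 < k \<and> k < N \<longrightarrow> A k = 0"
    \<comment> \<open>The term at 0 vanishes through \<open>d 0 = 0\<close>, all others through
      \<open>A k = 0\<close>.\<close>
    then have "(\<Sum>k<N. blinfun_apply (A k) (d k)) = 0" if "d 0 = 0" for d
      using that by (intro sum.neutral) (metis blinfun.zero_left blinfun.zero_right gr0I lessThan_iff)
    then show "FDLS_trajectory L f N q"
      by (simp add: FDLS_trajectory_def variation)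
  qed
  then show ?thesis by (simp only: A_0)
qed

theorem proposition4p7:
  fixes L :: "'a::real_normed_vector \<times> 'a \<Rightarrow> real"
    and f :: "('a \<times> 'a) one_form"
    and H :: "'a \<times> 'a dual \<Rightarrow> real"
    and \<phi> :: "('a \<times> 'a dual) one_form"
    and N :: nat
    and q :: "nat \<Rightarrow> 'a"
    and p :: "nat \<Rightarrow> 'a dual"
  assumes "finite_dim TYPE('a)"
    and "FDLS L f"
    and "MHC L f"
    and "H = Hamiltonian_of L f"
    and "\<phi> = force_of L f"
    and "N \<ge> 1"
    and "\<And>k. 1 \<le> k \<Longrightarrow> k \<le> N \<Longrightarrow> (q k, p k) = Legendre_plus L f (q (k - 1), q k)"
    and "(q 0, p 0) = Legendre_minus_H H \<phi> (q 0, p 1)"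
  shows "FDLS_trajectory L f N q \<longleftrightarrow> FDHS_extended_trajectory H \<phi> N q p"
proof -
  have L: "smooth L"
    using assms(2) by (simp add: FDLS_def)
  have p: "p (Suc k) = D2 L (q k, q (Suc k)) + form2 f (q k, q (Suc k))" if "k < N" for k
    using assms(7)[of "Suc k"] that by (simp add: Legendre_plus_def)
  note Hamilton = Hamiltonian_force_at_Legendre_tilde[OF L \<open>MHC L f\<close> p, folded assms(4,5)]
  have "p 0 = - D1 L (q 0, q (Suc 0)) - form1 f (q 0, q (Suc 0))"
    using assms(8) Hamilton(1)[of 0] \<open>N \<ge> 1\<close> by (simp add: Legendre_minus_H_def)
  then have "(0 < k \<and> k < N \<longrightarrow> p k = - D1 L (q k, q (Suc k)) - form1 f (q k, q (Suc k))) \<longleftrightarrow>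
      (k < N \<longrightarrow> p k = - D1 L (q k, q (Suc k)) - form1 f (q k, q (Suc k)))" for k
    by (cases k) simp_all
  moreover have "FDLS_trajectory L f N q \<longleftrightarrow>
      (\<forall>k. 0 < k \<and> k < N \<longrightarrow> p k = - D1 L (q k, q (Suc k)) - form1 f (q k, q (Suc k)))"
    by (rule FDLS_trajectory_iff[OF L]) (rule p)
  ultimately have "FDLS_trajectory L f N q \<longleftrightarrow>
      (\<forall>k<N. p k = - D1 L (q k, q (Suc k)) - form1 f (q k, q (Suc k)))"
    by simp
  also have "\<dots> \<longleftrightarrow> FDHS_extended_trajectory H \<phi> N q p"
    by (simp add: FDHS_extended_trajectory_def Hamilton)
  finally show ?thesis .
qed

end
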